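(* Let $k\ge 0$ and suppose there exists $M\ge 0$ such that $\|f\|_{H^{k}(0,\pi)}\le M$. Then $$\|f\|\le\left(\frac{D_{2}}{B_{1}\left(1-e^{-D_{1}T}\right)}\right)^{\frac{k}{k+2}}M^{\frac{2}{k+2}}\|g\|^{\frac{k}{k+2}}.$$
   Context: Let $T>0$ and let $a,\varphi:[0,T]\to\mathbb{R}$ be continuous with constants $B_1,B_2,D_1,D_2>0$ such that $B_1\le\varphi(t)\le B_2$ and $D_1\le a(t)\le D_2$ for all $t\in[0,T]$. $\|\cdot\|$ and $\langle\cdot,\cdot\rangle$ are the norm and inner product of $L^2(0,\pi)$, and $X_n(x)=\sqrt{2/\pi}\,\sin(nx)$, $n=1,2,\dots$, is the orthonormal basis of $L^2(0,\pi)$. Put $A(t)=\int_0^t a(s)\,ds$, $B(t)=A(t)-A(T)$ and $\Phi(n,h)=\int_0^T e^{n^2B(t)}h(t)\,dt$. Inverse source problem: $f$ is the source term in $u_t-(a(t)u_x)_x=\varphi(t)f(x)$ on $(0,\pi)\times(0,T)$, with $u(x,0)=0$, $u(x,T)=g(x)$, $u(0,t)=u(\pi,t)=0$. Solving by Fourier sine series, this means that $f,g\in L^2(0,\pi)$ are related by $\langle g,X_n\rangle=\Phi(n,\varphi)\langle f,X_n\rangle$ for all $n\ge1$. For $k\ge0$, $\|f\|_{H^k(0,\pi)}=\big(\sum_{n\ge1}(1+n^2)^k\langle f,X_n\rangle^2\big)^{1/2}$, and $H^k(0,\pi)$ is the set of $f\in L^2(0,\pi)$ for which this is finite. *)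

theory Defs
  imports "HOL-Analysis.Analysis"
begin

text \<open>Elements of L2(0,pi) are represented by functions, without passing to classes modulo
  almost-everywhere equality; inner product and norm depend only on the class.\<close>

definition L2_space :: "(real \<Rightarrow> real) set" where
  "L2_space = {f. f \<in> borel_measurable (lebesgue_on {0<..<pi}) \<and>
                  integrable (lebesgue_on {0<..<pi}) (\<lambda>x. (f x)\<^sup>2)}"

definition L2_inner :: "(real \<Rightarrow> real) \<Rightarrow> (real \<Rightarrow> real) \<Rightarrow> real" where
  "L2_inner f g = (\<integral>x. f x * g x \<partial>lebesgue_on {0<..<pi})"

definition L2_norm :: "(real \<Rightarrow> real) \<Rightarrow> real" where
  "L2_norm f = sqrt (L2_inner f f)"

definition X :: "nat \<Rightarrow> real \<Rightarrow> real" where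
  "X n x = sqrt (2 / pi) * sin (real n * x)"

text \<open>Since \<^const>\<open>infsum\<close> is 0 for a divergent family, \<open>Hk_norm\<close> is meaningful only on
  \<open>Hk_space\<close>, where finiteness of the norm is expressed by summability.\<close>

definition Hk_space :: "real \<Rightarrow> (real \<Rightarrow> real) set" where
  "Hk_space k = {f \<in> L2_space.
     (\<lambda>n. (1 + (real n)\<^sup>2) powr k * (L2_inner f (X n))\<^sup>2) summable_on {1..}}"

definition Hk_norm :: "real \<Rightarrow> (real \<Rightarrow> real) \<Rightarrow> real" where
  "Hk_norm k f =
     sqrt (\<Sum>\<^sub>\<infinity>n\<in>{1..}. (1 + (real n)\<^sup>2) powr k * (L2_inner f (X n))\<^sup>2)"

definition A :: "(real \<Rightarrow> real) \<Rightarrow> real \<Rightarrow> real" where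
  "A a t = integral {0..t} a"

definition B :: "(real \<Rightarrow> real) \<Rightarrow> real \<Rightarrow> real \<Rightarrow> real" where
  "B a T t = A a t - A a T"

definition Phi :: "(real \<Rightarrow> real) \<Rightarrow> real \<Rightarrow> nat \<Rightarrow> (real \<Rightarrow> real) \<Rightarrow> real" where
  "Phi a T n h = integral {0..T} (\<lambda>t. exp ((real n)\<^sup>2 * B a T t) * h t)"

text \<open>Fourier form of the inverse source problem: \<open>g\<close> is the final state \<open>u(\<cdot>, T)\<close> of the
  solution of \<open>u_t - (a(t) u_x)_x = \<phi>(t) f(x)\<close> on \<open>(0,pi) \<times> (0,T)\<close> with zero initial and
  zero Dirichlet boundary values.\<close>

definition source_data ::
  "(real \<Rightarrow> real) \<Rightarrow> (real \<Rightarrow> real) \<Rightarrow> real \<Rightarrow> (real \<Rightarrow> real) \<Rightarrow> (real \<Rightarrow> real) \<Rightarrow> bool" where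
  "source_data a \<phi> T f g \<longleftrightarrow> f \<in> L2_space \<and> g \<in> L2_space \<and>
     (\<forall>n\<ge>1. L2_inner g (X n) = Phi a T n \<phi> * L2_inner f (X n))"

end

theory Submission
  imports Defs
begin

text \<open>
  Write \<open>f\<^sub>n\<close> and \<open>g\<^sub>n\<close> for the sine coefficients of \<open>f\<close> and \<open>g\<close>. The data determine \<open>f\<^sub>n\<close> with a
  loss of only two derivatives: \<open>exp (n\<^sup>2 B t)\<close> has the derivative \<open>n\<^sup>2 a t exp (n\<^sup>2 B t)\<close>, so
  replacing \<open>\<phi>\<close> by its lower bound \<open>(B1 / D2) a\<close> turns the integral \<open>\<Phi>(n, \<phi>)\<close> into one that
  can be computed, and this gives \<open>\<bar>f\<^sub>n\<bar> \<le> C n\<^sup>2 \<bar>g\<^sub>n\<bar>\<close> with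
  \<open>C = D2 / (B1 (1 - exp (- D1 T)))\<close> (\<open>Phi_lower_bound\<close>, \<open>source_coefficient_bound\<close>).
  By Bessel's inequality the sum of \<open>f\<^sub>n\<^sup>2 / n\<^sup>4\<close> is therefore at most the square of \<open>C\<close> times
  the norm of \<open>g\<close>, while the a priori bound says that the sum of \<open>n\<^sup>2\<^sup>k f\<^sub>n\<^sup>2\<close> is at most
  \<open>M\<^sup>2\<close>. Interpolating between the weights \<open>n\<^sup>2\<^sup>k\<close> and \<open>1 / n\<^sup>4\<close> by Hoelder's inequality, with
  exponents \<open>2 / (k + 2)\<close> and \<open>k / (k + 2)\<close> for which the powers of \<open>n\<close> cancel, bounds every
  partial sum of \<open>f\<^sub>n\<^sup>2\<close> (\<open>sum_interpolation\<close>).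

  To pass from the coefficients back to the norm of \<open>f\<close> one needs that the sine system is complete
  (\<open>sine_polys_dense\<close>, \<open>Parseval_upper_bound\<close>). A function \<open>h x * sin x\<close> with \<open>h\<close> continuous is a
  uniform limit of sine polynomials, because \<open>h\<close> is a continuous function of \<open>cos x\<close> and
  Weierstrass' theorem applies; suitable products of this form converge almost everywhere, with a uniform bound, to
  any given bounded measurable function, and truncation leads from there to all of \<open>L\<^sup>2\<close>.
\<close>

section \<open>The inner product of square-integrable functions on the interval\<close>

abbreviation \<mu> :: "real measure" where
  "\<mu> \<equiv> lebesgue_on {0<..<pi}"

lemma L2_space_measurable: "f \<in> L2_space \<Longrightarrow> f \<in> borel_measurable \<mu>"
  by (simp add: L2_space_def)

lemma L2_space_integrable_power2: "f \<in> L2_space \<Longrightarrow> integrable \<mu> (\<lambda>x. (f x)\<^sup>2)"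
  by (simp add: L2_space_def)

lemma L2_space_integrable_mult:
  assumes "f \<in> L2_space" "g \<in> L2_space"
  shows "integrable \<mu> (\<lambda>x. f x * g x)"
proof (rule Bochner_Integration.integrable_bound)
  show "integrable \<mu> (\<lambda>x. (f x)\<^sup>2 + (g x)\<^sup>2)"
    using assms by (simp add: L2_space_def)
  show "(\<lambda>x. f x * g x) \<in> borel_measurable \<mu>"
    using assms[THEN L2_space_measurable] by measurable
  have "\<bar>a * b\<bar> \<le> a\<^sup>2 + b\<^sup>2" for a b :: real
    using sum_squares_bound[of "\<bar>a\<bar>" "\<bar>b\<bar>"] abs_ge_zero[of "a * b"]
    unfolding abs_mult power2_abs by linarith
  then show "AE x in \<mu>. norm (f x * g x) \<le> norm ((f x)\<^sup>2 + (g x)\<^sup>2)"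
    by simp
qed

lemma L2_space_lincomb:
  assumes "f \<in> L2_space" "g \<in> L2_space"
  shows "(\<lambda>x. a * f x + b * g x) \<in> L2_space"
proof -
  have "(\<lambda>x. a * f x + b * g x) \<in> borel_measurable \<mu>"
    using assms[THEN L2_space_measurable] by measurable
  moreover have "(\<lambda>x. (a * f x + b * g x)\<^sup>2) =
      (\<lambda>x. a\<^sup>2 * (f x)\<^sup>2 + 2 * a * b * (f x * g x) + b\<^sup>2 * (g x)\<^sup>2)"
    by (simp add: power2_eq_square algebra_simps)
  ultimately show ?thesis
    using assms L2_space_integrable_mult[OF assms] by (simp add: L2_space_def)
qed

lemma L2_space_diff:
  "f \<in> L2_space \<Longrightarrow> g \<in> L2_space \<Longrightarrow> (\<lambda>x. f x - g x) \<in> L2_space"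
  using L2_space_lincomb[of f g 1 "-1"] by simp

lemma bounded_in_L2_space:
  assumes m: "f \<in> borel_measurable \<mu>" and b: "\<And>x. x \<in> {0<..<pi} \<Longrightarrow> \<bar>f x\<bar> \<le> c"
  shows "f \<in> L2_space" and "L2_inner f f \<le> pi * c\<^sup>2"
proof -
  interpret finite_measure \<mu>
    by (rule finite_measure_lebesgue_on) simp
  have le: "(f x)\<^sup>2 \<le> c\<^sup>2" if "x \<in> {0<..<pi}" for x
    using b[OF that] by (metis abs_ge_zero power2_abs power_mono)
  have i: "integrable \<mu> (\<lambda>x. (f x)\<^sup>2)"
    by (rule integrable_const_bound[where B = "c\<^sup>2"]) (use m le in auto)
  with m show "f \<in> L2_space" by (simp add: L2_space_def)
  have "L2_inner f f = (\<integral>x. (f x)\<^sup>2 \<partial>\<mu>)"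
    by (simp add: L2_inner_def power2_eq_square)
  also have "\<dots> \<le> (\<integral>x. c\<^sup>2 \<partial>\<mu>)"
    by (rule integral_mono[OF i]) (use le in auto)
  also have "\<dots> = pi * c\<^sup>2"
    by (simp add: measure_restrict_space)
  finally show "L2_inner f f \<le> pi * c\<^sup>2" .
qed

lemma continuous_in_L2_space:
  assumes "continuous_on {0..pi} f"
  shows "f \<in> L2_space"
proof -
  have "bounded (f ` {0..pi})"
    using assms compact_continuous_image compact_imp_bounded by blast
  then obtain c where "\<And>x. x \<in> {0..pi} \<Longrightarrow> \<bar>f x\<bar> \<le> c"
    unfolding bounded_iff real_norm_def by blast
  moreover have "f \<in> borel_measurable \<mu>"
    by (rule continuous_imp_measurable_on_sets_lebesgue)
       (use assms continuous_on_subset greaterThanLessThan_subseteq_atLeastAtMost_iff in blast, simp)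
  ultimately show ?thesis
    by (intro bounded_in_L2_space(1)[of f c]) auto
qed

lemma X_in_L2_space: "X n \<in> L2_space"
  unfolding X_def
  by (rule continuous_in_L2_space) (intro continuous_intros)

lemma L2_inner_commute: "L2_inner f g = L2_inner g f"
  by (simp add: L2_inner_def mult.commute)

lemma L2_inner_nonneg: "L2_inner f f \<ge> 0"
  by (simp add: L2_inner_def)

lemma L2_norm_power2: "(L2_norm f)\<^sup>2 = L2_inner f f"
  by (simp add: L2_norm_def L2_inner_nonneg)

lemma L2_inner_lincomb:
  assumes "f \<in> L2_space" "g \<in> L2_space" "h \<in> L2_space"
  shows "L2_inner h (\<lambda>x. a * f x + b * g x) = a * L2_inner h f + b * L2_inner h g"
proof -
  have "L2_inner h (\<lambda>x. a * f x + b * g x) =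
      (\<integral>x. a * (h x * f x) + b * (h x * g x) \<partial>\<mu>)"
    by (simp add: L2_inner_def algebra_simps)
  also have "\<dots> = a * L2_inner h f + b * L2_inner h g"
    using L2_space_integrable_mult[of h f] L2_space_integrable_mult[of h g] assms
    by (simp add: L2_inner_def)
  finally show ?thesis .
qed

text \<open>Membership and the value of the inner product are established together, since the induction
  step for the latter needs the former.\<close>
lemma L2_inner_sum:
  assumes "h \<in> L2_space" "finite F" "\<And>n. n \<in> F \<Longrightarrow> u n \<in> L2_space"
  shows "(\<lambda>x. \<Sum>n\<in>F. c n * u n x) \<in> L2_space"
    and "L2_inner h (\<lambda>x. \<Sum>n\<in>F. c n * u n x) = (\<Sum>n\<in>F. c n * L2_inner h (u n))"
proof -
  have "(\<lambda>x. \<Sum>n\<in>F. c n * u n x) \<in> L2_space \<and>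
    L2_inner h (\<lambda>x. \<Sum>n\<in>F. c n * u n x) = (\<Sum>n\<in>F. c n * L2_inner h (u n))"
    using assms(2,3)
  proof (induction F)
    case empty
    show ?case by (simp add: L2_space_def L2_inner_def)
  next
    case (insert n F)
    then show ?case
      using L2_space_lincomb[of "u n" "\<lambda>x. \<Sum>n\<in>F. c n * u n x" "c n" 1]
        L2_inner_lincomb[of "u n" "\<lambda>x. \<Sum>n\<in>F. c n * u n x" h "c n" 1] assms(1)
      by simp
  qed
  then show "(\<lambda>x. \<Sum>n\<in>F. c n * u n x) \<in> L2_space"
    "L2_inner h (\<lambda>x. \<Sum>n\<in>F. c n * u n x) = (\<Sum>n\<in>F. c n * L2_inner h (u n))"
    by auto
qed

lemma L2_inner_diff_self:
  assumes "f \<in> L2_space" "g \<in> L2_space"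
  shows "L2_inner (\<lambda>x. f x - g x) (\<lambda>x. f x - g x) =
    L2_inner f f - 2 * L2_inner f g + L2_inner g g"
proof -
  let ?d = "\<lambda>x. f x - g x"
  have d: "L2_inner h ?d = L2_inner h f - L2_inner h g" if "h \<in> L2_space" for h
    using L2_inner_lincomb[of f g h 1 "-1"] assms that by simp
  have "L2_inner ?d ?d = L2_inner f ?d - L2_inner g ?d"
    using d[OF L2_space_diff[OF assms]] by (simp only: L2_inner_commute[of f] L2_inner_commute[of g])
  also have "\<dots> = L2_inner f f - 2 * L2_inner f g + L2_inner g g"
    using d[OF assms(1)] d[OF assms(2)] L2_inner_commute[of g f] by simp
  finally show ?thesis .
qed

section \<open>Orthonormality of the sine system and Bessel's inequality\<close>

lemma integral_sin_mult_sin: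
  fixes m n :: nat
  assumes "m \<ge> 1" "n \<ge> 1"
  shows "integral {0..pi} (\<lambda>x. sin (real m * x) * sin (real n * x)) = (if m = n then pi / 2 else 0)"
proof -
  have product: "sin (real m * x) * sin (real n * x) =
      (cos (real_of_int (int m - int n) * x) - cos (real_of_int (int m + int n) * x)) / 2" for x
    by (simp add: cos_diff cos_add algebra_simps)
  have "((\<lambda>x. cos (real_of_int j * x)) has_integral (if j = 0 then pi else 0)) {0..pi}" for j :: int
  proof (cases "j = 0")
    case False
    have "((\<lambda>x. cos (real_of_int j * x)) has_integral
        sin (real_of_int j * pi) / real_of_int j - sin (real_of_int j * 0) / real_of_int j) {0..pi}"
      by (rule fundamental_theorem_of_calculus)
         (use False in \<open>auto intro!: derivative_eq_intros
            simp flip: has_real_derivative_iff_has_vector_derivative\<close>)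
    moreover have "sin (real_of_int j * pi) = 0"
      unfolding sin_zero_iff_int2 by blast
    ultimately show ?thesis
      using False by simp
  next
    case True
    then show ?thesis
      using has_integral_const_real[of "1::real" 0 pi] by simp
  qed
  \<comment> \<open>For \<open>m, n \<ge> 1\<close> the frequency \<open>m + n\<close> is never zero, so only \<open>m - n\<close> can contribute.\<close>
  from has_integral_divide[OF has_integral_diff[OF this[of "int m - int n"] this[of "int m + int n"]], of 2]
  show ?thesis
    using assms unfolding product by (intro integral_unique) auto
qed

lemma X_orthonormal:
  assumes "m \<ge> 1" "n \<ge> 1"
  shows "L2_inner (X m) (X n) = (if m = n then 1 else 0)"
proof -
  have "L2_inner (X m) (X n) = integral {0<..<pi} (\<lambda>x. X m x * X n x)"
    unfolding L2_inner_def
    by (intro lebesgue_integral_eq_integral L2_space_integrable_mult X_in_L2_space) simp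
  also have "\<dots> = integral {0..pi} (\<lambda>x. (2 / pi) * (sin (real m * x) * sin (real n * x)))"
    unfolding integral_open_interval_real[symmetric] X_def
    by (intro integral_cong) (simp add: algebra_simps)
  also have "\<dots> = (if m = n then 1 else 0)"
    using integral_sin_mult_sin[OF assms] by simp
  finally show ?thesis .
qed

text \<open>Completing the square in each coefficient. Taking for \<open>c\<close> the sine coefficients of \<open>f\<close> yields
  Bessel's inequality; for an arbitrary \<open>c\<close> it shows that no sine polynomial of degree \<open>N\<close> is closer
  to \<open>f\<close> than the partial sum of its sine series.\<close>
lemma L2_dist_sine_sum:
  assumes f: "f \<in> L2_space"
  defines "s \<equiv> \<lambda>c N x. \<Sum>n\<in>{1..N}. c n * X n x"
  shows "L2_inner (\<lambda>x. f x - s c N x) (\<lambda>x. f x - s c N x) =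
    L2_inner f f - (\<Sum>n\<in>{1..N}. (L2_inner f (X n))\<^sup>2) + (\<Sum>n\<in>{1..N}. (c n - L2_inner f (X n))\<^sup>2)"
proof -
  have s: "s c N \<in> L2_space" and inner: "L2_inner h (s c N) = (\<Sum>n\<in>{1..N}. c n * L2_inner h (X n))"
    if "h \<in> L2_space" for h
    unfolding s_def using that X_in_L2_space by (auto intro!: L2_inner_sum)
  have coeff: "L2_inner (s c N) (X n) = c n" if "n \<in> {1..N}" for n
  proof -
    have "L2_inner (s c N) (X n) = (\<Sum>m\<in>{1..N}. c m * (if n = m then 1 else 0))"
      unfolding L2_inner_commute[of "s c N"] inner[OF X_in_L2_space]
      by (intro sum.cong refl) (use that in \<open>simp add: X_orthonormal\<close>)
    also have "\<dots> = c n"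
      using that by (simp add: if_distrib cong: if_cong)
    finally show ?thesis .
  qed
  have "L2_inner (s c N) (s c N) = (\<Sum>n\<in>{1..N}. c n * c n)"
    using inner[OF s[OF f]] coeff by simp
  moreover have "(\<Sum>n\<in>{1..N}. (c n - L2_inner f (X n))\<^sup>2) =
      (\<Sum>n\<in>{1..N}. (c n * c n - 2 * (c n * L2_inner f (X n))) + (L2_inner f (X n))\<^sup>2)"
    by (intro sum.cong refl) (simp add: power2_eq_square algebra_simps)
  ultimately show ?thesis
    unfolding L2_inner_diff_self[OF f s[OF f]] inner[OF f] sum.distrib sum_subtractf
      sum_distrib_left[symmetric]
    by simp
qed

lemma Bessel_inequality:
  assumes "f \<in> L2_space"
  shows "(\<Sum>n\<in>{1..N}. (L2_inner f (X n))\<^sup>2) \<le> L2_inner f f"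
  using L2_dist_sine_sum[OF assms, of "\<lambda>n. L2_inner f (X n)" N]
    L2_inner_nonneg[of "\<lambda>x. f x - (\<Sum>n\<in>{1..N}. L2_inner f (X n) * X n x)"]
  by simp

section \<open>Sine polynomials\<close>

definition sine_polys :: "(real \<Rightarrow> real) set" where
  "sine_polys = {s. \<exists>c N. s = (\<lambda>x. \<Sum>n\<in>{1..N}. c n * X n x)}"

lemma sine_polysI: "(\<And>x. s x = (\<Sum>n\<in>{1..N}. c n * X n x)) \<Longrightarrow> s \<in> sine_polys"
  unfolding sine_polys_def by blast

lemma sine_polys_lincomb:
  assumes "s \<in> sine_polys" "t \<in> sine_polys"
  shows "(\<lambda>x. a * s x + b * t x) \<in> sine_polys"
proof -
  obtain c N where s: "s = (\<lambda>x. \<Sum>n\<in>{1..N}. c n * X n x)"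
    using assms(1) by (auto simp: sine_polys_def)
  obtain d K where t: "t = (\<lambda>x. \<Sum>n\<in>{1..K}. d n * X n x)"
    using assms(2) by (auto simp: sine_polys_def)
  have pad: "(\<Sum>n\<in>{1..J}. e n * X n x) = (\<Sum>n\<in>{1..N+K}. (if n \<le> J then e n else 0) * X n x)"
    if "J \<le> N + K" for J x and e :: "nat \<Rightarrow> real"
    by (rule sum.mono_neutral_cong_left) (use that in auto)
  show ?thesis
  proof (rule sine_polysI)
    fix x
    have "s x = (\<Sum>n\<in>{1..N+K}. (if n \<le> N then c n else 0) * X n x)"
      "t x = (\<Sum>n\<in>{1..N+K}. (if n \<le> K then d n else 0) * X n x)"
      unfolding s t by (rule pad; simp)+
    then show "a * s x + b * t x = (\<Sum>n\<in>{1..N+K}.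
        (a * (if n \<le> N then c n else 0) + b * (if n \<le> K then d n else 0)) * X n x)"
      by (simp only: distrib_right sum.distrib sum_distrib_left mult.assoc)
  qed
qed

lemma X_in_sine_polys: "X n \<in> sine_polys"
proof (rule sine_polysI)
  show "X n x = (\<Sum>m\<in>{1..n}. (if m = n then 1 else 0) * X m x)" for x
    by (cases "n = 0") (simp_all add: X_def if_distrib if_distribR sum.delta cong: if_cong)
qed

lemma sine_polys_sum:
  assumes "finite F" "\<And>n. n \<in> F \<Longrightarrow> s n \<in> sine_polys"
  shows "(\<lambda>x. \<Sum>n\<in>F. c n * s n x) \<in> sine_polys"
  using assms
proof (induction F)
  case empty
  then show ?case
    using X_in_sine_polys[of 0] by (simp add: X_def[abs_def])
next
  case (insert n F)
  then show ?case
    using sine_polys_lincomb[of "s n" "\<lambda>x. \<Sum>n\<in>F. c n * s n x" "c n" 1] by simp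
qed

text \<open>This is the product formula
  \<open>2 sin (n x) cos x = sin ((n + 1) x) + sin ((n - 1) x)\<close>. For \<open>n = 1\<close> the second summand is the
  zero function, so the product does not leave the span of the sines.\<close>
lemma sine_polys_mult_cos:
  assumes "s \<in> sine_polys"
  shows "(\<lambda>x. s x * cos x) \<in> sine_polys"
proof -
  obtain c N where s: "s = (\<lambda>x. \<Sum>n\<in>{1..N}. c n * X n x)"
    using assms by (auto simp: sine_polys_def)
  have "X n x * cos x = 1/2 * X (n + 1) x + 1/2 * X (n - 1) x" if "n \<ge> 1" for n x
    using that by (simp add: X_def of_nat_diff distrib_right left_diff_distrib sin_add sin_diff field_simps)
  then have "(\<lambda>x. s x * cos x) =
      (\<lambda>x. \<Sum>n\<in>{1..N}. c n * (1/2 * X (n + 1) x + 1/2 * X (n - 1) x))"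
    unfolding s sum_distrib_right by (intro ext sum.cong refl) (simp add: mult.assoc)
  then show ?thesis
    by (simp only:) (intro sine_polys_sum sine_polys_lincomb X_in_sine_polys finite_atLeastAtMost)
qed

text \<open>This lets Weierstrass' theorem for polynomials take the place of a convergence theorem for
  Fourier series.\<close>
lemma sin_mult_polynomial_cos:
  assumes "real_polynomial_function p"
  shows "(\<lambda>x. p (cos x) * sin x) \<in> sine_polys"
proof -
  obtain a n where p: "p = (\<lambda>y. \<Sum>i\<le>n. a i * y ^ i)"
    using assms unfolding real_polynomial_function_iff_sum by blast
  have power: "(\<lambda>x. sin x * cos x ^ i) \<in> sine_polys" for i
  proof (induction i)
    case 0
    have "(\<lambda>x. sqrt (pi / 2) * X 1 x + 0 * X 1 x) = sin"
      by (simp add: X_def fun_eq_iff flip: mult.assoc real_sqrt_mult)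
    then show ?case
      using sine_polys_lincomb[OF X_in_sine_polys X_in_sine_polys, of "sqrt (pi / 2)" 1 0 1] by simp
  next
    case (Suc i)
    from sine_polys_mult_cos[OF this] show ?case
      by (simp add: mult_ac)
  qed
  have "(\<lambda>x. p (cos x) * sin x) = (\<lambda>x. \<Sum>i\<le>n. a i * (sin x * cos x ^ i))"
    unfolding p sum_distrib_right by (simp only: mult_ac)
  then show ?thesis
    using sine_polys_sum[of "{..n}" "\<lambda>i x. sin x * cos x ^ i" a] power by simp
qed

lemma sine_polys_subset_L2_space: "s \<in> sine_polys \<Longrightarrow> s \<in> L2_space"
  using L2_inner_sum(1)[of "X 0" _ X] X_in_L2_space by (auto simp: sine_polys_def)

section \<open>Completeness of the sine system\<close>

definition sine_closure :: "(real \<Rightarrow> real) set" where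
  "sine_closure = {f \<in> L2_space.
     \<forall>e>0. \<exists>s\<in>sine_polys. L2_inner (\<lambda>x. f x - s x) (\<lambda>x. f x - s x) < e}"

lemma L2_space_integrable_diff_power2:
  assumes "f \<in> L2_space" "g \<in> L2_space"
  shows "integrable \<mu> (\<lambda>x. (f x - g x)\<^sup>2)"
  using L2_space_diff[OF assms] by (rule L2_space_integrable_power2)

text \<open>A triangle inequality for squared distances: the factor 2 comes from
  \<open>(p + q)\<^sup>2 + (p - q)\<^sup>2 = 2 p\<^sup>2 + 2 q\<^sup>2\<close>. It is all that an epsilon argument needs, and it
  dispenses with square roots.\<close>
lemma L2_dist_le:
  assumes "f \<in> L2_space" "g \<in> L2_space" "h \<in> L2_space"
  shows "L2_inner (\<lambda>x. f x - h x) (\<lambda>x. f x - h x) \<le>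
    2 * L2_inner (\<lambda>x. f x - g x) (\<lambda>x. f x - g x) + 2 * L2_inner (\<lambda>x. g x - h x) (\<lambda>x. g x - h x)"
proof -
  have "(\<integral>x. (f x - h x)\<^sup>2 \<partial>\<mu>) \<le> (\<integral>x. 2 * (f x - g x)\<^sup>2 + 2 * (g x - h x)\<^sup>2 \<partial>\<mu>)"
  proof (rule integral_mono)
    fix x
    have "2 * (f x - g x)\<^sup>2 + 2 * (g x - h x)\<^sup>2 - (f x - h x)\<^sup>2 = (f x - 2 * g x + h x)\<^sup>2"
      by (simp add: power2_eq_square algebra_simps)
    then show "(f x - h x)\<^sup>2 \<le> 2 * (f x - g x)\<^sup>2 + 2 * (g x - h x)\<^sup>2"
      using zero_le_power2[of "f x - 2 * g x + h x"] by linarith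
  qed (use assms L2_space_integrable_diff_power2 in auto)
  then show ?thesis
    using assms L2_space_integrable_diff_power2 by (simp add: L2_inner_def flip: power2_eq_square)
qed

lemma sine_closure_closed:
  assumes f: "f \<in> L2_space" and u: "\<And>n. u n \<in> sine_closure"
    and lim: "(\<lambda>n::nat. L2_inner (\<lambda>x. f x - u n x) (\<lambda>x. f x - u n x)) \<longlonglongrightarrow> 0"
  shows "f \<in> sine_closure"
  unfolding sine_closure_def
proof (intro CollectI conjI f allI impI)
  fix e :: real assume "e > 0"
  then have "eventually (\<lambda>n. L2_inner (\<lambda>x. f x - u n x) (\<lambda>x. f x - u n x) < e / 4) sequentially"
    using order_tendstoD(2)[OF lim, of "e / 4"] by simp
  then obtain n where n: "L2_inner (\<lambda>x. f x - u n x) (\<lambda>x. f x - u n x) < e / 4"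
    by (auto dest: eventually_happens)
  obtain s where s: "s \<in> sine_polys" "L2_inner (\<lambda>x. u n x - s x) (\<lambda>x. u n x - s x) < e / 4"
    using u[of n] \<open>e > 0\<close> unfolding sine_closure_def
    by (auto dest!: spec[of _ "e / 4"])
  have "u n \<in> L2_space"
    using u[of n] by (simp add: sine_closure_def)
  from L2_dist_le[OF f this sine_polys_subset_L2_space[OF s(1)]]
  have "L2_inner (\<lambda>x. f x - s x) (\<lambda>x. f x - s x) < e"
    using n s(2) by linarith
  with s(1) show "\<exists>s\<in>sine_polys. L2_inner (\<lambda>x. f x - s x) (\<lambda>x. f x - s x) < e"
    by blast
qed

lemma L2_dominated_convergence:
  assumes f: "f \<in> L2_space" and w: "w \<in> L2_space" and u: "\<And>n. u n \<in> L2_space"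
    and lim: "AE x in \<mu>. (\<lambda>n::nat. u n x) \<longlonglongrightarrow> f x"
    and le: "\<And>n x. x \<in> {0<..<pi} \<Longrightarrow> \<bar>u n x\<bar> \<le> w x"
  shows "(\<lambda>n. L2_inner (\<lambda>x. f x - u n x) (\<lambda>x. f x - u n x)) \<longlonglongrightarrow> 0"
proof -
  have "(\<lambda>n. \<integral>x. (f x - u n x)\<^sup>2 \<partial>\<mu>) \<longlonglongrightarrow> (\<integral>x. 0 \<partial>\<mu>)"
  proof (rule integral_dominated_convergence[where w = "\<lambda>x. 2 * (f x)\<^sup>2 + 2 * (w x)\<^sup>2"])
    show "AE x in \<mu>. (\<lambda>n. (f x - u n x)\<^sup>2) \<longlonglongrightarrow> 0"
      using lim
    proof eventually_elim
      fix x assume "(\<lambda>n. u n x) \<longlonglongrightarrow> f x"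
      then have "(\<lambda>n. (f x - u n x)\<^sup>2) \<longlonglongrightarrow> (f x - f x)\<^sup>2"
        by (intro tendsto_intros)
      then show "(\<lambda>n. (f x - u n x)\<^sup>2) \<longlonglongrightarrow> 0" by simp
    qed
    show "AE x in \<mu>. norm ((f x - u n x)\<^sup>2) \<le> 2 * (f x)\<^sup>2 + 2 * (w x)\<^sup>2" for n
    proof (rule AE_I2)
      fix x assume "x \<in> space \<mu>"
      then have "(u n x)\<^sup>2 \<le> (w x)\<^sup>2"
        using le[of x n] by (metis abs_ge_zero power2_abs power_mono space_lebesgue_on)
      moreover have "2 * (f x)\<^sup>2 + 2 * (u n x)\<^sup>2 - (f x - u n x)\<^sup>2 = (f x + u n x)\<^sup>2"
        by (simp add: power2_eq_square algebra_simps)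
      ultimately show "norm ((f x - u n x)\<^sup>2) \<le> 2 * (f x)\<^sup>2 + 2 * (w x)\<^sup>2"
        using zero_le_power2[of "f x + u n x"] unfolding real_norm_def abs_power2 by linarith
    qed
    show "(\<lambda>x. (f x - u n x)\<^sup>2) \<in> borel_measurable \<mu>" for n
      using L2_space_integrable_diff_power2[OF f u] by (rule borel_measurable_integrable)
    show "integrable \<mu> (\<lambda>x. 2 * (f x)\<^sup>2 + 2 * (w x)\<^sup>2)"
      using f w by (simp add: L2_space_def)
  qed simp
  then show ?thesis
    by (simp add: L2_inner_def power2_eq_square)
qed

text \<open>On \<open>[0, pi]\<close> the cosine is a homeomorphism onto \<open>[-1, 1]\<close>, so \<open>h\<close> is a continuous function of
  \<open>cos x\<close> and hence a uniform limit of polynomials in \<open>cos x\<close>.\<close>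
lemma continuous_mult_sin_in_sine_closure:
  assumes h: "continuous_on {0..pi} h"
  shows "(\<lambda>x. h x * sin x) \<in> sine_closure"
  unfolding sine_closure_def
proof (intro CollectI conjI allI impI)
  show L2: "(\<lambda>x. h x * sin x) \<in> L2_space"
    by (intro continuous_in_L2_space continuous_intros h)
  fix e :: real assume "e > 0"
  define d where "d = sqrt (e / (2 * pi))"
  have d: "d > 0" "pi * d\<^sup>2 < e"
    using \<open>e > 0\<close> by (auto simp: d_def)
  have "continuous_on {-1..1} (\<lambda>y. h (arccos y))"
    by (rule continuous_on_compose2[OF h continuous_on_arccos'])
       (auto simp: arccos_lbound arccos_ubound)
  then obtain p where p: "real_polynomial_function p"
      "\<And>y. y \<in> {-1..1} \<Longrightarrow> \<bar>h (arccos y) - p y\<bar> < d"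
    using Stone_Weierstrass_real_polynomial_function[OF compact_Icc _ d(1)] by blast
  let ?s = "\<lambda>x. p (cos x) * sin x"
  have s: "?s \<in> sine_polys"
    by (rule sin_mult_polynomial_cos[OF p(1)])
  have "\<bar>h x * sin x - ?s x\<bar> \<le> d" if "x \<in> {0<..<pi}" for x
  proof -
    have "\<bar>h x * sin x - ?s x\<bar> = \<bar>h (arccos (cos x)) - p (cos x)\<bar> * \<bar>sin x\<bar>"
      using that by (simp add: arccos_cos left_diff_distrib flip: abs_mult)
    also have "\<dots> \<le> d * 1"
      using p(2)[of "cos x"] d by (intro mult_mono) auto
    finally show ?thesis by simp
  qed
  then have "L2_inner (\<lambda>x. h x * sin x - ?s x) (\<lambda>x. h x * sin x - ?s x) \<le> pi * d\<^sup>2"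
    by (intro bounded_in_L2_space(2) L2_space_measurable L2_space_diff L2
        sine_polys_subset_L2_space s)
  with d s show "\<exists>s\<in>sine_polys. L2_inner (\<lambda>x. h x * sin x - s x) (\<lambda>x. h x * sin x - s x) < e"
    by (intro bexI[OF _ s]) auto
qed

text \<open>A measurable function is an almost everywhere limit of continuous functions \<open>g n\<close>. Two
  modifications bring these into the form \<open>h x * sin x\<close> without affecting the limit: clamping
  their values to \<open>[-c, c]\<close> keeps them uniformly bounded, and multiplying by
  \<open>sin x / max (sin x) (1 / (n + 1))\<close>, which tends to 1 inside the interval, produces the factor
  \<open>sin x\<close> while keeping the quotient continuous up to the end points.\<close>
lemma bounded_in_sine_closure:
  assumes m: "f \<in> borel_measurable \<mu>" and b: "\<And>x. x \<in> {0<..<pi} \<Longrightarrow> \<bar>f x\<bar> \<le> c"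
  shows "f \<in> sine_closure"
proof -
  have c: "c \<ge> 0"
    using b[of "pi / 2"] by (simp add: field_simps)
  have "f measurable_on {0<..<pi}"
    using m by (simp add: measurable_on_iff_borel_measurable)
  then obtain N g where N: "negligible N" and g: "\<And>n::nat. continuous_on UNIV (g n)"
    and lim: "\<And>x. x \<notin> N \<Longrightarrow> (\<lambda>n. g n x) \<longlonglongrightarrow> (if x \<in> {0<..<pi} then f x else 0)"
    unfolding measurable_on_def by blast
  define h where "h n x = max (- c) (min c (g n x)) / max (sin x) (1 / real (Suc n))" for n x
  let ?u = "\<lambda>n x. h n x * sin x"
  have pos: "max (sin x) (1 / real (Suc n)) > 0" for n x
    by (simp add: less_max_iff_disj)
  have h: "continuous_on {0..pi} (h n)" for n
    unfolding h_def
    using pos by (intro continuous_intros continuous_on_subset[OF g] subset_UNIV)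
      (metis less_irrefl)
  have f: "f \<in> L2_space"
    by (rule bounded_in_L2_space(1)[OF m b])
  show ?thesis
  proof (rule sine_closure_closed[OF f, of ?u])
    show "?u n \<in> sine_closure" for n
      by (rule continuous_mult_sin_in_sine_closure[OF h])
    show "(\<lambda>n. L2_inner (\<lambda>x. f x - ?u n x) (\<lambda>x. f x - ?u n x)) \<longlonglongrightarrow> 0"
    proof (rule L2_dominated_convergence[where w = "\<lambda>_. c"])
      show "(\<lambda>_. c) \<in> L2_space" "?u n \<in> L2_space" for n
        by (intro continuous_in_L2_space continuous_intros h)+
      have "(\<lambda>n. ?u n x) \<longlonglongrightarrow> f x" if x: "x \<in> {0<..<pi}" "x \<notin> N" for x
      proof -
        have sin: "sin x > 0"
          using x by (intro sin_gt_zero) auto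
        have "(\<lambda>n. max (- c) (min c (g n x))) \<longlonglongrightarrow> max (- c) (min c (f x))"
          using lim[OF x(2)] x(1) by (intro tendsto_intros) simp
        also have "max (- c) (min c (f x)) = f x"
          using b[OF x(1)] by linarith
        finally have clamped: "(\<lambda>n. max (- c) (min c (g n x))) \<longlonglongrightarrow> f x" .
        have "(\<lambda>n. max (- c) (min c (g n x)) / max (sin x) (1 / real (Suc n)) * sin x)
            \<longlonglongrightarrow> f x / max (sin x) 0 * sin x"
          using sin by (intro tendsto_intros clamped LIMSEQ_Suc[OF lim_1_over_n]) auto
        then show ?thesis
          using sin by (simp add: h_def)
      qed
      then have "AE x in lebesgue. x \<in> {0<..<pi} \<longrightarrow> (\<lambda>n. ?u n x) \<longlonglongrightarrow> f x"
        using N by (intro AE_I'[of N]) (auto simp: negligible_iff_null_sets)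
      then show "AE x in \<mu>. (\<lambda>n. ?u n x) \<longlonglongrightarrow> f x"
        by (subst AE_restrict_space_iff) auto
      show "\<bar>?u n x\<bar> \<le> c" if "x \<in> {0<..<pi}" for n x
      proof -
        have sin: "sin x > 0"
          using that by (intro sin_gt_zero) auto
        let ?m = "max (sin x) (1 / real (Suc n))"
        have "\<bar>?u n x\<bar> = \<bar>max (- c) (min c (g n x))\<bar> * (sin x / ?m)"
          using pos[of x n] sin by (simp add: h_def abs_mult)
        also have "\<dots> \<le> c * 1"
          using c pos[of x n] sin by (intro mult_mono) auto
        finally show ?thesis by simp
      qed
    qed (rule f)
  qed
qed

text \<open>Truncating the values of \<open>f\<close> to \<open>[-n, n]\<close> reduces the claim to bounded functions.\<close>
lemma sine_polys_dense:
  assumes f: "f \<in> L2_space"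
  shows "f \<in> sine_closure"
proof (rule sine_closure_closed[OF f])
  let ?u = "\<lambda>n x. max (- real n) (min (real n) (f x))"
  have [measurable]: "f \<in> borel_measurable \<mu>"
    by (rule L2_space_measurable[OF f])
  have m: "?u n \<in> borel_measurable \<mu>" for n
    by measurable
  have b: "\<bar>?u n x\<bar> \<le> real n" for n x
    by auto
  show "?u n \<in> sine_closure" for n
    by (rule bounded_in_sine_closure[OF m b])
  show "(\<lambda>n. L2_inner (\<lambda>x. f x - ?u n x) (\<lambda>x. f x - ?u n x)) \<longlonglongrightarrow> 0"
  proof (rule L2_dominated_convergence[OF f, where w = "\<lambda>x. \<bar>f x\<bar>"])
    show "(\<lambda>x. \<bar>f x\<bar>) \<in> L2_space"
      using f by (simp add: L2_space_def)
    show "?u n \<in> L2_space" for n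
      by (rule bounded_in_L2_space(1)[OF m b])
    show "AE x in \<mu>. (\<lambda>n. ?u n x) \<longlonglongrightarrow> f x"
    proof (rule AE_I2)
      fix x
      have "eventually (\<lambda>n. ?u n x = f x) sequentially"
        using eventually_ge_at_top[of "nat \<lceil>\<bar>f x\<bar>\<rceil>"]
        by eventually_elim linarith
      then show "(\<lambda>n. ?u n x) \<longlonglongrightarrow> f x"
        by (rule tendsto_eventually)
    qed
    show "\<bar>?u n x\<bar> \<le> \<bar>f x\<bar>" for n x
      by auto
  qed
qed

text \<open>The half of Parseval's identity that expresses completeness. It is phrased with a bound on the
  partial sums because that is what the interpolation of finite sums provides.\<close>
lemma Parseval_upper_bound:
  assumes f: "f \<in> L2_space" and le: "\<And>N. (\<Sum>n\<in>{1..N}. (L2_inner f (X n))\<^sup>2) \<le> R"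
  shows "L2_inner f f \<le> R"
proof (rule field_le_epsilon)
  fix e :: real assume "e > 0"
  then obtain s where "s \<in> sine_polys" and s: "L2_inner (\<lambda>x. f x - s x) (\<lambda>x. f x - s x) < e"
    using sine_polys_dense[OF f] unfolding sine_closure_def by blast
  then obtain c N where s_eq: "s = (\<lambda>x. \<Sum>n\<in>{1..N}. c n * X n x)"
    unfolding sine_polys_def by blast
  have "0 \<le> (\<Sum>n\<in>{1..N}. (c n - L2_inner f (X n))\<^sup>2)"
    by (intro sum_nonneg) simp
  then show "L2_inner f f \<le> R + e"
    using s L2_dist_sine_sum[OF f, of c N] le[of N] unfolding s_eq by linarith
qed

section \<open>Recovering the source coefficients from the data\<close>

text \<open>Since \<open>a / D2 \<le> 1 \<le> \<phi> / B1\<close>, the integrand of \<open>Phi a T n \<phi>\<close> is at least \<open>B1 / D2\<close> times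
  \<open>a t * exp (n\<^sup>2 * B a T t)\<close>, and \<open>n\<^sup>2\<close> times the latter is an exact derivative, with integral
  \<open>1 - exp (- n\<^sup>2 * A a T) \<ge> 1 - exp (- D1 * T)\<close>.\<close>
lemma Phi_lower_bound:
  fixes T B1 D1 D2 :: real
  assumes T: "T > 0" and a: "continuous_on {0..T} a" and \<phi>: "continuous_on {0..T} \<phi>"
    and pos: "B1 > 0" "D1 > 0" "D2 > 0" and n: "n \<ge> 1"
    and \<phi>_ge: "\<And>t. t \<in> {0..T} \<Longrightarrow> B1 \<le> \<phi> t"
    and a_bd: "\<And>t. t \<in> {0..T} \<Longrightarrow> D1 \<le> a t \<and> a t \<le> D2"
  shows "B1 * (1 - exp (- D1 * T)) \<le> D2 * (real n)\<^sup>2 * Phi a T n \<phi>"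
proof -
  define E where "E t = exp ((real n)\<^sup>2 * B a T t)" for t
  have dA: "(A a has_real_derivative a t) (at t within {0..T})" if "t \<in> {0..T}" for t
    unfolding A_def[abs_def] by (rule integral_has_real_derivative[OF a that])
  have dE: "(E has_real_derivative (real n)\<^sup>2 * a t * E t) (at t within {0..T})" if "t \<in> {0..T}" for t
    unfolding E_def[abs_def] B_def by (auto intro!: derivative_eq_intros dA[OF that])
  have contE: "continuous_on {0..T} E"
    by (rule DERIV_continuous_on[OF dE])
  have "((\<lambda>t. (real n)\<^sup>2 * a t * E t) has_integral E T - E 0) {0..T}"
    using T dE by (intro fundamental_theorem_of_calculus)
      (auto simp flip: has_real_derivative_iff_has_vector_derivative)
  then have exact: "integral {0..T} (\<lambda>t. (real n)\<^sup>2 * a t * E t) = E T - E 0"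
    by (rule integral_unique)
  have "D1 * T \<le> A a T"
  proof -
    have "integral {0..T} (\<lambda>_. D1) \<le> integral {0..T} a"
      using a_bd by (intro integral_le integrable_continuous_real a continuous_intros) auto
    with T show ?thesis by (simp add: A_def mult.commute)
  qed
  moreover have "1 \<le> (real n)\<^sup>2" using n by simp
  ultimately have "D1 * T \<le> (real n)\<^sup>2 * A a T"
    using mult_mono[of 1 "(real n)\<^sup>2" "D1 * T" "A a T"] pos T by simp
  moreover have "A a 0 = 0" by (simp add: A_def)
  ultimately have "1 - exp (- D1 * T) \<le> E T - E 0"
    by (simp add: E_def B_def)
  then have "B1 * (1 - exp (- D1 * T)) \<le> B1 * (E T - E 0)"
    using pos by (intro mult_left_mono) auto
  also have "\<dots> = integral {0..T} (\<lambda>t. B1 * ((real n)\<^sup>2 * a t * E t))"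
    by (simp only: integral_mult_right exact)
  also have "\<dots> \<le> integral {0..T} (\<lambda>t. D2 * (real n)\<^sup>2 * (E t * \<phi> t))"
  proof (intro integral_le integrable_continuous_real continuous_intros contE a \<phi>)
    fix t assume t: "t \<in> {0..T}"
    have "a t * B1 \<le> D2 * \<phi> t"
      using a_bd[OF t] \<phi>_ge[OF t] pos by (intro mult_mono) auto
    then have "(a t * B1) * ((real n)\<^sup>2 * E t) \<le> (D2 * \<phi> t) * ((real n)\<^sup>2 * E t)"
      by (intro mult_right_mono) (auto simp: E_def)
    then show "B1 * ((real n)\<^sup>2 * a t * E t) \<le> D2 * (real n)\<^sup>2 * (E t * \<phi> t)"
      by (simp add: algebra_simps)
  qed
  also have "\<dots> = D2 * (real n)\<^sup>2 * Phi a T n \<phi>"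
    by (simp only: integral_mult_right Phi_def E_def)
  finally show ?thesis .
qed

lemma source_coefficient_bound:
  fixes T B1 D1 D2 :: real
  assumes "T > 0" "continuous_on {0..T} a" "continuous_on {0..T} \<phi>"
    and pos: "B1 > 0" "D1 > 0" "D2 > 0" and n: "n \<ge> 1"
    and "\<And>t. t \<in> {0..T} \<Longrightarrow> B1 \<le> \<phi> t"
    and "\<And>t. t \<in> {0..T} \<Longrightarrow> D1 \<le> a t \<and> a t \<le> D2"
    and data: "source_data a \<phi> T f g"
  shows "(L2_inner f (X n))\<^sup>2 / real n ^ 4 \<le>
    (D2 / (B1 * (1 - exp (- D1 * T))))\<^sup>2 * (L2_inner g (X n))\<^sup>2"
proof -
  define \<delta> where "\<delta> = B1 * (1 - exp (- D1 * T))"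
  have \<delta>: "\<delta> > 0"
    using assms(1) pos by (simp add: \<delta>_def)
  have "\<delta> \<le> D2 * (real n)\<^sup>2 * Phi a T n \<phi>"
    unfolding \<delta>_def by (rule Phi_lower_bound) (use assms in auto)
  then have "\<delta>\<^sup>2 * (L2_inner f (X n))\<^sup>2 \<le>
      (D2 * (real n)\<^sup>2 * Phi a T n \<phi>)\<^sup>2 * (L2_inner f (X n))\<^sup>2"
    using \<delta> by (intro mult_right_mono power_mono) auto
  also have "\<dots> = D2\<^sup>2 * real n ^ 4 * (L2_inner g (X n))\<^sup>2"
    using data n by (simp add: source_data_def power_mult_distrib)
  finally show ?thesis
    unfolding \<delta>_def[symmetric] using \<delta> n by (simp add: power_divide field_simps)
qed

section \<open>Interpolation and the stability estimate\<close>

text \<open>Hoelder's inequality for the factorization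
  \<open>x n = (n\<^sup>2\<^sup>k x n) powr \<theta> * (x n / n\<^sup>4) powr \<eta>\<close>, which holds because \<open>k \<theta> = 2 \<eta>\<close> and
  \<open>\<theta> + \<eta> = 1\<close>. The proof is the usual one: divide the two factors by the bounds \<open>P\<close> and \<open>Q\<close>, apply
  Young's inequality to each term and sum.\<close>
lemma sum_interpolation:
  fixes x :: "nat \<Rightarrow> real" and k P Q :: real
  assumes "finite F" "\<And>n. n \<in> F \<Longrightarrow> n \<ge> 1" "\<And>n. n \<in> F \<Longrightarrow> x n \<ge> 0" "k \<ge> 0" "P > 0" "Q > 0"
    and P: "(\<Sum>n\<in>F. (real n)\<^sup>2 powr k * x n) \<le> P" and Q: "(\<Sum>n\<in>F. x n / (real n) ^ 4) \<le> Q"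
  shows "(\<Sum>n\<in>F. x n) \<le> P powr (2 / (k + 2)) * Q powr (k / (k + 2))"
proof -
  define \<theta> \<eta> where "\<theta> = 2 / (k + 2)" and "\<eta> = k / (k + 2)"
  have "\<theta> \<ge> 0" "\<eta> \<ge> 0"
    using \<open>k \<ge> 0\<close> by (auto simp: \<theta>_def \<eta>_def)
  moreover have "\<theta> + \<eta> = 1"
    unfolding \<theta>_def \<eta>_def add_divide_distrib[symmetric] using \<open>k \<ge> 0\<close> by simp
  ultimately have \<theta>: "\<theta> \<ge> 0" "\<eta> \<ge> 0" "\<theta> + \<eta> = 1"
    by auto
  have exponent: "k * \<theta> = 2 * \<eta>"
    by (simp add: \<theta>_def \<eta>_def)
  let ?R = "P powr \<theta> * Q powr \<eta>"
  have term_le: "x n \<le> ?R * (\<theta> * ((real n)\<^sup>2 powr k * x n / P) + \<eta> * (x n / (real n) ^ 4 / Q))"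
    if n: "n \<in> F" for n
  proof (cases "x n = 0")
    case False
    define m where "m = (real n)\<^sup>2"
    have pos: "x n > 0" "m > 0"
      using False assms(2,3)[OF n] by (auto simp: m_def)
    have m2: "real n ^ 4 = m powr 2"
      using pos by (simp add: m_def powr_numeral)
    define p q where "p = m powr k * x n" and "q = x n / m powr 2"
    have pq: "p > 0" "q > 0"
      using pos by (auto simp: p_def q_def)
    have "x n = p powr \<theta> * q powr \<eta>"
    proof -
      have "p powr \<theta> = m powr (2 * \<eta>) * x n powr \<theta>"
        using pos unfolding p_def exponent[symmetric] by (subst powr_mult) (auto simp: powr_powr)
      moreover have "q powr \<eta> = x n powr \<eta> / m powr (2 * \<eta>)"
        using pos unfolding q_def by (subst powr_divide) (auto simp: powr_powr simp del: powr_numeral)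
      ultimately have "p powr \<theta> * q powr \<eta> = x n powr \<theta> * x n powr \<eta>"
        using pos by simp
      also have "\<dots> = x n"
        using pos \<theta>(3) powr_add[of "x n" \<theta> \<eta>] by simp
      finally show ?thesis ..
    qed
    also have "\<dots> = ?R * ((p / P) powr \<theta> * (q / Q) powr \<eta>)"
      using pq assms by (simp add: powr_divide)
    also have "\<dots> \<le> ?R * (\<theta> * (p / P) + \<eta> * (q / Q))"
      using pq assms \<theta> by (intro mult_left_mono Youngs_inequality_0) auto
    finally show ?thesis
      by (simp add: p_def q_def m2 flip: m_def)
  qed (use assms \<theta> in simp)
  have "(\<Sum>n\<in>F. x n) \<le>
      (\<Sum>n\<in>F. ?R * (\<theta> * ((real n)\<^sup>2 powr k * x n / P) + \<eta> * (x n / (real n) ^ 4 / Q)))"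
    by (intro sum_mono term_le)
  also have "\<dots> = ?R * (\<theta> * ((\<Sum>n\<in>F. (real n)\<^sup>2 powr k * x n) / P) +
      \<eta> * ((\<Sum>n\<in>F. x n / (real n) ^ 4) / Q))"
    unfolding sum_distrib_left[symmetric] sum.distrib sum_divide_distrib[symmetric] ..
  also have "\<dots> \<le> ?R * (\<theta> * 1 + \<eta> * 1)"
    using assms \<theta> by (intro mult_left_mono add_mono) (auto simp: divide_le_eq_1)
  finally show ?thesis
    using \<theta> by (simp add: \<theta>_def \<eta>_def)
qed

lemma Hk_partial_sum_le:
  assumes "f \<in> Hk_space k" "Hk_norm k f \<le> M" "k \<ge> 0"
  shows "(\<Sum>n\<in>{1..N}. (real n)\<^sup>2 powr k * (L2_inner f (X n))\<^sup>2) \<le> M\<^sup>2"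
proof -
  let ?h = "\<lambda>n. (1 + (real n)\<^sup>2) powr k * (L2_inner f (X n))\<^sup>2"
  have "(\<Sum>n\<in>{1..N}. (real n)\<^sup>2 powr k * (L2_inner f (X n))\<^sup>2) \<le> sum ?h {1..N}"
    using \<open>k \<ge> 0\<close> by (intro sum_mono mult_right_mono powr_mono2) auto
  also have "\<dots> \<le> infsum ?h {1..}"
    using assms(1) by (intro finite_sum_le_infsum) (auto simp: Hk_space_def)
  also have "\<dots> \<le> M\<^sup>2"
    using assms(2) sqrt_le_D unfolding Hk_norm_def by blast
  finally show ?thesis .
qed

theorem theorem2p1:
  fixes T B1 B2 D1 D2 k M :: real
    and a \<phi> f g :: "real \<Rightarrow> real"
  assumes "T > 0"
    and "continuous_on {0..T} a"
    and "continuous_on {0..T} \<phi>"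
    and "B1 > 0" and "B2 > 0" and "D1 > 0" and "D2 > 0"
    and "\<And>t. t \<in> {0..T} \<Longrightarrow> B1 \<le> \<phi> t \<and> \<phi> t \<le> B2"
    and "\<And>t. t \<in> {0..T} \<Longrightarrow> D1 \<le> a t \<and> a t \<le> D2"
    and "source_data a \<phi> T f g"
    and "k \<ge> 0"
    and "M \<ge> 0"
    and "f \<in> Hk_space k"
    and "Hk_norm k f \<le> M"
  shows "L2_norm f \<le>
    (D2 / (B1 * (1 - exp (- D1 * T)))) powr (k / (k + 2)) *
    M powr (2 / (k + 2)) * L2_norm g powr (k / (k + 2))"
proof -
  define C where "C = D2 / (B1 * (1 - exp (- D1 * T)))"
  let ?F = "\<lambda>n. (L2_inner f (X n))\<^sup>2"
  let ?R = "C powr (k / (k + 2)) * M powr (2 / (k + 2)) * L2_norm g powr (k / (k + 2))"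
  have C: "C > 0"
    using assms by (simp add: C_def)
  have L2: "f \<in> L2_space" "g \<in> L2_space"
    using \<open>source_data a \<phi> T f g\<close> by (auto simp: source_data_def)
  have smooth: "(\<Sum>n\<in>{1..N}. (real n)\<^sup>2 powr k * ?F n) \<le> M\<^sup>2" for N
    by (rule Hk_partial_sum_le) fact+
  have coeff: "?F n / real n ^ 4 \<le> C\<^sup>2 * (L2_inner g (X n))\<^sup>2" if "n \<ge> 1" for n
    unfolding C_def by (rule source_coefficient_bound) (use assms that in auto)
  have data: "(\<Sum>n\<in>{1..N}. ?F n / real n ^ 4) \<le> (C * L2_norm g)\<^sup>2" for N
  proof -
    have "(\<Sum>n\<in>{1..N}. ?F n / real n ^ 4) \<le> (\<Sum>n\<in>{1..N}. C\<^sup>2 * (L2_inner g (X n))\<^sup>2)"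
      by (intro sum_mono coeff) simp
    also have "\<dots> \<le> C\<^sup>2 * L2_inner g g"
      unfolding sum_distrib_left[symmetric] by (intro mult_left_mono Bessel_inequality L2) simp
    finally show ?thesis
      by (simp add: power_mult_distrib L2_norm_power2)
  qed
  have G: "L2_norm g \<ge> 0"
    by (simp add: L2_norm_def L2_inner_nonneg)
  \<comment> \<open>The interpolation is applied with positive bounds only. If one of them is zero, all sine coefficients of
    \<open>f\<close> vanish; this case also absorbs the convention \<open>0 powr 0 = 0\<close>, which makes the right-hand side
    zero when \<open>k = 0\<close> and \<open>g\<close> has norm zero.\<close>
  have "(\<Sum>n\<in>{1..N}. ?F n) \<le> ?R\<^sup>2" for N
  proof (cases "M = 0 \<or> L2_norm g = 0")
    case False
    have "(\<Sum>n\<in>{1..N}. ?F n) \<le> M\<^sup>2 powr (2 / (k + 2)) * (C * L2_norm g)\<^sup>2 powr (k / (k + 2))"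
      by (rule sum_interpolation[OF _ _ _ \<open>k \<ge> 0\<close> _ _ smooth data]) (use False C in auto)
    also have "\<dots> = ?R\<^sup>2"
    proof -
      have "(x\<^sup>2) powr y = (x powr y)\<^sup>2" if "x > 0" for x y :: real
        using that by (simp add: power2_eq_square powr_mult)
      then show ?thesis
        using False C G \<open>M \<ge> 0\<close> by (simp add: powr_mult power_mult_distrib)
    qed
    finally show ?thesis .
  next
    case True
    have "?F n = 0" if n: "n \<in> {1..N}" for n
    proof (cases "M = 0")
      case True
      then have "(real n)\<^sup>2 powr k * ?F n \<le> 0"
        using member_le_sum[OF n, of "\<lambda>n. (real n)\<^sup>2 powr k * ?F n"] smooth[of N] by simp
      with n show ?thesis by (auto simp: mult_le_0_iff)
    next
      case False
      with True have "?F n / real n ^ 4 \<le> 0"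
        using member_le_sum[OF n, of "\<lambda>n. ?F n / real n ^ 4"] data[of N] by simp
      with n show ?thesis by (auto simp: divide_le_0_iff)
    qed
    then show ?thesis by simp
  qed
  then have "(L2_norm f)\<^sup>2 \<le> ?R\<^sup>2"
    unfolding L2_norm_power2 by (rule Parseval_upper_bound[OF L2(1)])
  then show ?thesis
    unfolding C_def[symmetric] by (rule power2_le_imp_le) simp
qed

end
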